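(* Let $G$ be a finite Abelian group, written multiplicatively, with elements $g_0,\dots,g_{\ell-1}$. Let $p$ be a probability distribution on $G$ such that the $\ell\times\ell$ doubly stochastic matrix ${\cal P}$ with elements ${\cal P}_{ab}=p(g_a^{-1}g_b)$ is ergodic. Let $q^{(0)}$ be a probability (row) vector with $\ell$ components, let $q^{(k)}=q^{(0)}{\cal P}^k$ for $k=0,1,2,\dots$, and let ${\bf u}=\left(\frac1\ell,\dots,\frac1\ell\right)$. Then $$\lim_{k\to\infty}q^{(k)}={\bf u},\qquad \lim_{k\to\infty}E[q^{(k)}]=\log\ell,\qquad \lim_{k\to\infty}{\cal G}[q^{(k)}]=0.$$ Also, the polytope ${\cal A}(q^{(k)})$ shrinks to the single point ${\bf u}$ as $k\to\infty$, i.e. ${\cal A}(q^{(k)})$ converges to $\{{\bf u}\}$ (in Hausdorff distance). Moreover, during time evolution the total variation distance of $q^{(k)}$ from ${\bf u}$ decreases: $$\|q^{(0)}-{\bf u}\|\ge\|q^{(1)}-{\bf u}\|\ge\|q^{(2)}-{\bf u}\|\ge\cdots.$$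
   Context: Probability vectors are row vectors ${\bf x}=(x_0,\dots,x_{\ell-1})$ with $x_a\ge 0$ and $\sum_a x_a=1$; matrices act on them from the right. A doubly stochastic $\ell\times\ell$ matrix ${\cal P}$ has an eigenvalue $e_0=1$; it is called ergodic if all its other $\ell-1$ eigenvalues $e_1,\dots,e_{\ell-1}$ (counted with multiplicity) satisfy $|e_i|<1$. For such a matrix $\lim_{k\to\infty}{\cal P}^k=\frac1\ell J_\ell$, where $J_\ell$ is the $\ell\times\ell$ matrix with all elements equal to one. Entropy: $E({\bf x})=-\sum_a x_a\log x_a$ (with $0\log 0=0$). Gini index: ${\cal G}({\bf x})=\frac{1}{2(\ell+1)}\sum_{a,b}|x_a-x_b|$. The polytope of a probability vector ${\bf x}$ is ${\cal A}({\bf x})=\{{\bf x}{\cal Q}\,:\,{\cal Q}\in{\cal B}\}$, where ${\cal B}$ is the Birkhoff polytope of all $\ell\times\ell$ doubly stochastic matrices. (A probability vector may be represented by its first $\ell-1$ components as a point of $[0,1]^{\ell-1}$.) Total variation distance: $\|{\bf x}-{\bf y}\|=\frac12\sum_a|x_a-y_a|$. *)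

theory Defs
  imports "HOL-Analysis.Analysis" "HOL-Algebra.Group" "HOL-Computational_Algebra.Polynomial"
begin

text \<open>Probability vectors are row vectors \<^typ>\<open>real ^ 'n\<close> on which square matrices act from the
  right through \<^const>\<open>vector_matrix_mult\<close>; the number of components is \<^term>\<open>CARD('n)\<close>.\<close>

definition prob_vector :: "real ^ 'n \<Rightarrow> bool" where
  "prob_vector x \<longleftrightarrow> (\<forall>a. x $ a \<ge> 0) \<and> (\<Sum>a\<in>UNIV. x $ a) = 1"

definition uniform_vector :: "real ^ 'n" where
  "uniform_vector = (\<chi> a. 1 / real CARD('n))"

definition doubly_stochastic :: "real ^ 'n ^ 'n \<Rightarrow> bool" where
  "doubly_stochastic Q \<longleftrightarrow> (\<forall>a b. Q $ a $ b \<ge> 0)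
     \<and> (\<forall>a. (\<Sum>b\<in>UNIV. Q $ a $ b) = 1) \<and> (\<forall>b. (\<Sum>a\<in>UNIV. Q $ a $ b) = 1)"

primrec matrix_pow :: "'a::semiring_1 ^ 'n ^ 'n \<Rightarrow> nat \<Rightarrow> 'a ^ 'n ^ 'n" where
  "matrix_pow A 0 = mat 1"
| "matrix_pow A (Suc k) = matrix_pow A k ** A"

definition characteristic_poly :: "'a::comm_ring_1 ^ 'n ^ 'n \<Rightarrow> 'a poly" where
  "characteristic_poly A = det (\<chi> i j. (if i = j then [:0, 1:] else 0) - [:A $ i $ j:])"

text \<open>All \<^term>\<open>CARD('n)\<close> complex eigenvalues of a real matrix, with algebraic multiplicity.\<close>

definition eigenvalues :: "real ^ 'n ^ 'n \<Rightarrow> complex multiset" where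
  "eigenvalues A = proots (characteristic_poly (\<chi> i j. complex_of_real (A $ i $ j)))"

text \<open>Meant for doubly stochastic matrices, where \<open>1\<close> is always an eigenvalue: removing one
  occurrence of it leaves the other \<^term>\<open>CARD('n) - 1\<close> eigenvalues, so that a
  multiple eigenvalue \<open>1\<close> rules out ergodicity.\<close>

definition ergodic :: "real ^ 'n ^ 'n \<Rightarrow> bool" where
  "ergodic A \<longleftrightarrow> (\<forall>e \<in># eigenvalues A - {#1#}. cmod e < 1)"

text \<open>Since \<open>0 * ln 0 = 0\<close>, the usual convention for vanishing components is respected.\<close>

definition entropy :: "real ^ 'n \<Rightarrow> real" where
  "entropy x = - (\<Sum>a\<in>UNIV. x $ a * ln (x $ a))"

definition gini :: "real ^ 'n \<Rightarrow> real" where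
  "gini x = 1 / (2 * (real CARD('n) + 1)) * (\<Sum>a\<in>UNIV. \<Sum>b\<in>UNIV. \<bar>x $ a - x $ b\<bar>)"

definition polytope_of :: "real ^ 'n \<Rightarrow> (real ^ 'n) set" where
  "polytope_of x = {x v* Q | Q. doubly_stochastic Q}"

definition tv_dist :: "real ^ 'n \<Rightarrow> real ^ 'n \<Rightarrow> real" where
  "tv_dist x y = 1 / 2 * (\<Sum>a\<in>UNIV. \<bar>x $ a - y $ a\<bar>)"

text \<open>Hausdorff distance with respect to the ambient metric; being real-valued, it is only
  meaningful for nonempty bounded sets, such as the polytopes above.\<close>

definition hausdorff_distance :: "'a::metric_space set \<Rightarrow> 'a set \<Rightarrow> real" where
  "hausdorff_distance S T = max (SUP x\<in>S. infdist x T) (SUP y\<in>T. infdist y S)"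

end

theory Submission
  imports Defs "HOL-Computational_Algebra.Fundamental_Theorem_Algebra"
begin

text \<open>The deviation \<open>q0 - u\<close> lies in the invariant subspace \<open>V\<close> of vectors with component sum
  zero. Adding all columns of \<open>X I - P\<close> to one of them pulls the factor \<open>X - 1\<close> out of the
  characteristic polynomial, and every eigenvalue of \<open>P\<close> on \<open>V\<close> is a root of the cofactor;
  hence ergodicity bounds all eigenvalues on \<open>V\<close> by less than \<open>1\<close>. That the powers of \<open>P\<close> then
  tend to \<open>0\<close> on \<open>V\<close> needs no normal form: pick a polynomial annihilating a given vector \<open>x\<close> and
  a root \<open>c\<close> of it. By induction on the degree the powers applied to \<open>x P - c x\<close> tend to \<open>0\<close>; if
  \<open>\<bar>c\<bar> < 1\<close>, the recurrence \<open>x P\<^bsup>k+1\<^esup> = c x P\<^bsup>k\<^esup> + (x P - c x) P\<^bsup>k\<^esup>\<close> transfers this to \<open>x\<close>, and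
  otherwise \<open>c\<close> is not an eigenvalue on \<open>V\<close>, so the linear factor can be cancelled.
  The Hausdorff distance and the monotonicity follow because doubly stochastic matrices fix \<open>u\<close>
  and contract the \<open>L\<^sup>1\<close> norm.\<close>

section \<open>Scalar recurrences with a contracting factor\<close>

lemma tendsto_zero_of_contractive_recurrence:
  fixes a b :: "nat \<Rightarrow> 'a::real_normed_field"
  assumes rec: "\<And>k. a (Suc k) = c * a k + b k" and b: "b \<longlonglongrightarrow> 0" and c: "norm c < 1"
  shows "a \<longlonglongrightarrow> 0"
proof (rule LIMSEQ_I)
  fix e :: real assume e: "0 < e"
  \<comment> \<open>With this \<open>d\<close>, the number \<open>e / 2\<close> is the fixed point
    of the map t to \<open>norm c * t + d\<close>, so perturbations below \<open>d\<close>
    contribute at most \<open>e / 2\<close> in total.\<close>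
  define d where "d = (1 - norm c) * (e / 2)"
  have "0 < d" using c e by (simp add: d_def)
  then obtain N where N: "\<And>n. n \<ge> N \<Longrightarrow> norm (b n) < d"
    using LIMSEQ_D[OF b] by (metis diff_zero)
  have bound: "norm (a (N + m)) \<le> norm c ^ m * norm (a N) + e / 2" for m
  proof (induction m)
    case 0
    show ?case using e by simp
  next
    case (Suc m)
    have "norm (a (N + Suc m)) \<le> norm c * norm (a (N + m)) + d"
      using norm_triangle_ineq[of "c * a (N + m)" "b (N + m)"] N[of "N + m"]
      by (simp add: rec norm_mult)
    also have "\<dots> \<le> norm c * (norm c ^ m * norm (a N) + e / 2) + d"
      using Suc.IH by (simp add: mult_left_mono)
    finally show ?case by (simp add: d_def field_simps)
  qed
  have "(\<lambda>m. norm c ^ m * norm (a N)) \<longlonglongrightarrow> 0"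
    using c by (intro tendsto_mult_left_zero LIMSEQ_power_zero) simp
  then obtain M where M: "\<And>m. m \<ge> M \<Longrightarrow> norm (norm c ^ m * norm (a N)) < e / 2"
    using LIMSEQ_D[of _ 0 "e / 2"] e by (metis diff_zero half_gt_zero)
  show "\<exists>no. \<forall>n\<ge>no. norm (a n - 0) < e"
  proof (intro exI allI impI)
    fix n assume n: "n \<ge> N + M"
    then have "norm (a n) \<le> norm c ^ (n - N) * norm (a N) + e / 2"
      using bound[of "n - N"] by simp
    moreover have "norm c ^ (n - N) * norm (a N) < e / 2"
      using M[of "n - N"] n by simp
    ultimately show "norm (a n - 0) < e" by simp
  qed
qed

section \<open>Polynomials in a matrix, acting on row vectors\<close>

text \<open>This is the row vector \<open>x\<close> times the matrix p(A), evaluated by Horner's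
  scheme. The recursion moves \<open>A\<close> onto the vector, so proofs go by induction on
  \<open>p\<close> for arbitrary \<open>x\<close>.\<close>

definition poly_act :: "'a::comm_ring_1 ^ 'n ^ 'n \<Rightarrow> 'a poly \<Rightarrow> 'a ^ 'n \<Rightarrow> 'a ^ 'n" where
  "poly_act A p = fold_coeffs (\<lambda>a h x. a *s x + h (x v* A)) p (\<lambda>_. 0)"

lemma poly_act_0 [simp]: "poly_act A 0 x = 0"
  by (simp add: poly_act_def)

lemma poly_act_pCons [simp]: "poly_act A (pCons a p) x = a *s x + poly_act A p (x v* A)"
  by (cases "p = 0 \<and> a = 0") (auto simp: poly_act_def)

lemma vector_scalar_mult_matrix:
  "(c *s x) v* A = c *s (x v* A)" for c :: "'a::comm_ring_1"
  by (simp add: vector_matrix_mult_def vec_eq_iff sum_distrib_left mult.assoc)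

lemma poly_act_add: "poly_act A (p + q) x = poly_act A p x + poly_act A q x"
  by (induction p q arbitrary: x rule: poly_induct2) simp_all

lemma poly_act_smult: "poly_act A (smult c p) x = c *s poly_act A p x"
  by (induction p arbitrary: x) simp_all

lemma poly_act_monom: "poly_act A (monom c n) x = c *s ((\<lambda>y. y v* A) ^^ n) x"
  by (induction n arbitrary: x)
    (simp_all add: monom_0 monom_Suc funpow_swap1[of "\<lambda>y. y v* A", symmetric])

lemma poly_act_sum:
  "finite I \<Longrightarrow> poly_act A (\<Sum>i\<in>I. f i) x = (\<Sum>i\<in>I. poly_act A (f i) x)"
  by (induction I rule: finite_induct) (simp_all add: poly_act_add)

lemma poly_act_diff_right: "poly_act A p (x - y) = poly_act A p x - poly_act A p y"
  by (induction p arbitrary: x y)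
    (simp_all add: vector_matrix_mult_diff_distrib)

lemma poly_act_scale_right: "poly_act A p (c *s x) = c *s poly_act A p x"
  by (induction p arbitrary: x)
    (simp_all add: vector_scalar_mult_matrix mult.commute)

lemma poly_act_commute: "poly_act A p (x v* A) = poly_act A p x v* A"
  by (induction p arbitrary: x)
    (simp_all add: vector_scalar_mult_matrix vector_matrix_left_distrib)

text \<open>Putting the linear factor on the vector side lets an induction on the degree trade
  \<open>x\<close> for \<open>x v* A - c *s x\<close>.\<close>

lemma poly_act_linear_factor:
  "poly_act A ([:- c, 1:] * p) x = poly_act A p (x v* A - c *s x)"
proof -
  have "[:- c, 1:] * p = smult (- c) p + pCons 0 p" by simp
  then show ?thesis
    by (simp only: poly_act_add poly_act_smult poly_act_diff_right poly_act_scale_right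
        poly_act_pCons) (simp add: vec_eq_iff)
qed

lemma poly_act_in_subspace:
  fixes A :: "'a::field ^ 'n ^ 'n"
  assumes "vec.subspace V" and "\<And>x. x \<in> V \<Longrightarrow> x v* A \<in> V" and "x \<in> V"
  shows "poly_act A p x \<in> V"
  using assms(3)
  by (induction p arbitrary: x)
    (simp_all add: assms(1,2) vec.subspace_0 vec.subspace_add vec.subspace_scale)

text \<open>More iterates of \<open>x\<close> than the real dimension of the space are linearly
  dependent, and the coefficients of a relation are those of the polynomial.\<close>

lemma exists_annihilating_poly:
  fixes A :: "complex ^ 'n ^ 'n"
  shows "\<exists>p. p \<noteq> 0 \<and> poly_act A p x = 0"
proof -
  define orb where "orb = (\<lambda>i. ((\<lambda>y. y v* A) ^^ i) x)"
  define N where "N = DIM(complex ^ 'n)"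
  show ?thesis
  \<comment> \<open>Dependence is a property of the set of iterates and does not see repetitions;
    two equal iterates instead yield a difference of two monomials.\<close>
  proof (cases "inj_on orb {..N}")
    case True
    then have "card (orb ` {..N}) > DIM(complex ^ 'n)"
      by (simp add: card_image N_def)
    then have "dependent (orb ` {..N})"
      by (intro dependent_biggerset)
    then obtain u where u: "\<exists>v\<in>orb ` {..N}. u v \<noteq> 0" "(\<Sum>v\<in>orb ` {..N}. u v *\<^sub>R v) = 0"
      by (auto simp: real_vector.dependent_finite)
    define p where "p = (\<Sum>i\<le>N. monom (complex_of_real (u (orb i))) i)"
    have "poly_act A p x = (\<Sum>i\<le>N. complex_of_real (u (orb i)) *s orb i)"
      by (simp add: p_def poly_act_sum poly_act_monom orb_def)
    also have "\<dots> = (\<Sum>i\<le>N. u (orb i) *\<^sub>R orb i)"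
      by (simp add: vec_eq_iff flip: scaleR_conv_of_real)
    also have "\<dots> = 0"
      using u(2) sum.reindex[OF True, of "\<lambda>v. u v *\<^sub>R v"] by simp
    finally have "poly_act A p x = 0" .
    moreover have "coeff p i = complex_of_real (u (orb i))" if "i \<le> N" for i
      using that by (simp add: p_def coeff_sum)
    then have "p \<noteq> 0" using u(1) by fastforce
    ultimately show ?thesis by blast
  next
    case False
    then obtain i j where ij: "i \<noteq> j" "orb i = orb j" by (auto simp: inj_on_def)
    have "poly_act A (monom 1 i + smult (- 1) (monom 1 j)) x = 0"
      using ij(2) unfolding poly_act_add poly_act_smult poly_act_monom orb_def by simp
    moreover have "coeff (monom (1::complex) i + smult (- 1) (monom 1 j)) i \<noteq> 0"
      using ij(1) by simp
    ultimately show ?thesis by (metis coeff_0)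
  qed
qed

section \<open>Powers on an invariant subspace\<close>

lemma powers_tendsto_zero_on_subspace:
  fixes A :: "complex ^ 'n ^ 'n"
  assumes V: "vec.subspace V" and inv: "\<And>x. x \<in> V \<Longrightarrow> x v* A \<in> V"
    and no_eig: "\<And>c x. \<lbrakk>x \<in> V; x v* A = c *s x; 1 \<le> cmod c\<rbrakk> \<Longrightarrow> x = 0"
    and x: "x \<in> V"
  shows "(\<lambda>k. ((\<lambda>y. y v* A) ^^ k) x) \<longlonglongrightarrow> 0"
proof -
  \<comment> \<open>Both \<open>p\<close> and \<open>x\<close> vary in the induction: its hypothesis
    is applied to \<open>r\<close> and \<open>y\<close> in one case, to \<open>r\<close> and
    \<open>x\<close> in the other.\<close>
  have "(\<lambda>k. ((\<lambda>y. y v* A) ^^ k) x) \<longlonglongrightarrow> 0"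
    if "degree p = n" "p \<noteq> 0" "poly_act A p x = 0" "x \<in> V" for p x n
    using that
  proof (induction n arbitrary: p x)
    case 0
    then obtain a where "p = [:a:]" "a \<noteq> 0" by (metis degree_eq_zeroE pCons_0_0)
    then have "x = 0" using 0 by simp
    moreover have "((\<lambda>y. y v* A) ^^ k) 0 = 0" for k by (induction k) simp_all
    ultimately show ?case by simp
  next
    case (Suc n)
    obtain c where "poly p c = 0"
      using fundamental_theorem_of_algebra[of p] Suc.prems(1) constant_degree[of p] by auto
    then obtain r where r: "p = [:- c, 1:] * r"
      by (metis poly_eq_0_iff_dvd dvdE)
    have r0: "r \<noteq> 0" using r Suc.prems(2) by auto
    have deg: "degree r = n"
      using Suc.prems(1) r0 degree_mult_eq[of "[:- c, 1:]" r] by (simp add: r del: mult_pCons_left)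
    define y where "y = x v* A - c *s x"
    have y: "y \<in> V" "poly_act A r y = 0"
      using Suc.prems(3,4) inv V
      by (simp_all only: r y_def poly_act_linear_factor vec.subspace_diff vec.subspace_scale)
    show ?case
    proof (cases "cmod c < 1")
      case True
      have lim: "(\<lambda>k. ((\<lambda>y. y v* A) ^^ k) y) \<longlonglongrightarrow> 0"
        by (rule Suc.IH[OF deg r0 y(2,1)])
      have "((\<lambda>y. y v* A) ^^ Suc k) x
          = c *s ((\<lambda>y. y v* A) ^^ k) x + ((\<lambda>y. y v* A) ^^ k) y" for k
        by (induction k)
          (simp_all add: y_def vector_matrix_left_distrib vector_scalar_mult_matrix)
      \<comment> \<open>The recurrence lemma speaks of field elements, so the vector identity is
        read off componentwise.\<close>
      then have rec: "((\<lambda>y. y v* A) ^^ Suc k) x $ j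
          = c * ((\<lambda>y. y v* A) ^^ k) x $ j + ((\<lambda>y. y v* A) ^^ k) y $ j" for k j
        by simp
      show ?thesis
      proof (rule vec_tendstoI)
        fix j
        have "(\<lambda>k. ((\<lambda>y. y v* A) ^^ k) y $ j) \<longlonglongrightarrow> 0"
          using tendsto_vec_nth[OF lim, of j] by simp
        from tendsto_zero_of_contractive_recurrence[OF rec this True]
        show "(\<lambda>k. ((\<lambda>y. y v* A) ^^ k) x $ j) \<longlonglongrightarrow> 0 $ j" by simp
      qed
    next
      case False
      \<comment> \<open>A nonzero \<open>poly_act A r x\<close> would be an eigenvector in
        \<open>V\<close> for \<open>c\<close>, which is excluded; hence \<open>r\<close> alone
        annihilates \<open>x\<close>.\<close>
      have "poly_act A r x v* A - c *s poly_act A r x = 0"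
        using y(2) by (simp add: y_def poly_act_diff_right poly_act_scale_right poly_act_commute)
      then have "poly_act A r x = 0"
        using no_eig[of "poly_act A r x" c] False poly_act_in_subspace[OF V inv Suc.prems(4)]
        by simp
      then show ?thesis using Suc.IH[OF deg r0 _ Suc.prems(4)] by blast
    qed
  qed
  then show ?thesis using exists_annihilating_poly[of A x] x by blast
qed

section \<open>Determinants and stochastic matrices\<close>

lemma poly_det: "poly (det A) z = det (\<chi> i j. poly (A $ i $ j) z)"
  by (simp add: det_def poly_sum poly_prod)

lemma det_eq_0_iff_left_kernel:
  fixes A :: "'a::field ^ 'n ^ 'n"
  shows "det A = 0 \<longleftrightarrow> (\<exists>x. x \<noteq> 0 \<and> x v* A = 0)"
proof -
  have "det A = 0 \<longleftrightarrow> \<not> invertible (transpose A)"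
    by (simp add: invertible_det_nz)
  then show ?thesis
    using matrix_left_invertible_ker[of "transpose A"] by (auto simp: invertible_left_inverse)
qed

text \<open>Replacing column \<open>k\<close> by the sum of all columns keeps the determinant, since
  every other summand repeats a column; the new column is \<open>s\<close> times the all-ones
  column. The computation runs on the rows of the transpose.\<close>

lemma det_equal_row_sums:
  fixes A :: "'a::comm_ring_1 ^ 'n ^ 'n"
  assumes "\<And>i. (\<Sum>j\<in>UNIV. A $ i $ j) = s"
  shows "det A = s * det (\<chi> i j. if j = k then 1 else A $ i $ j)"
proof -
  define B where "B = transpose A"
  have B: "(\<Sum>j\<in>UNIV. B $ j) = s *s 1"
    using assms by (simp add: B_def transpose_def vec_eq_iff)
  have off: "det (\<chi> i. if i = k then B $ j else B $ i) = 0" if "j \<noteq> k" for j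
    by (rule det_identical_rows[OF that]) (use that in \<open>simp add: row_def vec_eq_iff\<close>)
  have "det (\<chi> i. if i = k then \<Sum>j\<in>UNIV. B $ j else B $ i)
      = (\<Sum>j\<in>UNIV. det (\<chi> i. if i = k then B $ j else B $ i))"
    by (rule det_linear_row_sum) simp
  also have "\<dots> = (\<Sum>j\<in>UNIV. if j = k then det (\<chi> i. if i = k then B $ k else B $ i) else 0)"
    by (rule sum.cong) (use off in auto)
  also have "\<dots> = det (\<chi> i. if i = k then B $ k else B $ i)" by simp
  also have "(\<chi> i. if i = k then B $ k else B $ i) = B" by (simp add: vec_eq_iff)
  finally have "det B = s * det (\<chi> i. if i = k then 1 else B $ i)"
    unfolding B by (simp add: det_row_mul)
  moreover have "transpose (\<chi> i. if i = k then 1 else B $ i)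
      = (\<chi> i j. if j = k then 1 else A $ i $ j)"
    by (simp add: B_def transpose_def vec_eq_iff)
  ultimately show ?thesis by (metis B_def det_transpose)
qed

lemma sum_vector_matrix_mult:
  fixes x :: "'a::comm_ring_1 ^ 'n" and A :: "'a ^ 'm ^ 'n"
  assumes "\<And>a. (\<Sum>b\<in>UNIV. A $ a $ b) = 1"
  shows "(\<Sum>b\<in>UNIV. (x v* A) $ b) = (\<Sum>a\<in>UNIV. x $ a)"
proof -
  have "(\<Sum>b\<in>UNIV. (x v* A) $ b) = (\<Sum>a\<in>UNIV. \<Sum>b\<in>UNIV. x $ a * A $ a $ b)"
    unfolding vector_matrix_mult_def by (subst sum.swap) simp
  then show ?thesis by (simp add: assms flip: sum_distrib_left)
qed

text \<open>The triangle inequality and the unit row sums give the bound. General scalars serve both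
  complex eigenvectors and real differences of probability vectors.\<close>

lemma l1_vector_stochastic_le:
  fixes x :: "'a::{real_normed_field} ^ 'n" and A :: "real ^ 'm ^ 'n"
  assumes "\<And>a b. 0 \<le> A $ a $ b" and "\<And>a. (\<Sum>b\<in>UNIV. A $ a $ b) = 1"
  shows "(\<Sum>b\<in>UNIV. norm ((x v* (\<chi> i j. of_real (A $ i $ j))) $ b)) \<le> (\<Sum>a\<in>UNIV. norm (x $ a))"
proof -
  have "(\<Sum>b\<in>UNIV. norm ((x v* (\<chi> i j. of_real (A $ i $ j))) $ b))
      \<le> (\<Sum>b\<in>UNIV. \<Sum>a\<in>UNIV. norm (x $ a) * A $ a $ b)"
    using assms(1)
    by (intro sum_mono)
      (auto simp: vector_matrix_mult_def norm_mult intro!: order.trans[OF norm_sum] sum_mono)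
  also have "\<dots> = (\<Sum>a\<in>UNIV. norm (x $ a))"
    by (subst sum.swap) (simp add: assms(2) flip: sum_distrib_left)
  finally show ?thesis .
qed

lemma l1_vector_doubly_stochastic_le:
  fixes x :: "real ^ 'n"
  assumes "doubly_stochastic Q"
  shows "(\<Sum>b\<in>UNIV. \<bar>(x v* Q) $ b\<bar>) \<le> (\<Sum>a\<in>UNIV. \<bar>x $ a\<bar>)"
  using l1_vector_stochastic_le[of Q x] assms by (simp add: doubly_stochastic_def)

lemma poly_characteristic_poly:
  "poly (characteristic_poly A) z = det (\<chi> i j. (if i = j then z else 0) - A $ i $ j)"
  unfolding characteristic_poly_def poly_det
  by (intro arg_cong[of _ _ det]) (simp add: vec_eq_iff)

lemma vector_mult_characteristic_matrix:
  fixes A :: "'a::comm_ring_1 ^ 'n ^ 'n"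
  shows "x v* (\<chi> i j. (if i = j then z else 0) - A $ i $ j) = z *s x - x v* A"
  by (simp add: vector_matrix_mult_def vec_eq_iff right_diff_distrib sum_subtractf
      if_distrib[of "(*) _"] mult.commute cong: if_cong)

section \<open>Ergodicity on vectors of component sum zero\<close>

text \<open>That \<open>c\<close> is a root of the characteristic polynomial is not enough:
  \<open>c\<close> may be 1, and one occurrence of 1 is discarded. The zero sum of \<open>x\<close>
  makes \<open>c\<close> a root of the cofactor \<open>D\<close>, whose roots are exactly the
  remaining eigenvalues.\<close>

lemma ergodic_no_eigenvector:
  fixes A :: "real ^ 'n ^ 'n" and x :: "complex ^ 'n"
  assumes nonneg: "\<And>a b. 0 \<le> A $ a $ b" and rows: "\<And>a. (\<Sum>b\<in>UNIV. A $ a $ b) = 1"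
    and erg: "ergodic A"
    and x: "(\<Sum>a\<in>UNIV. x $ a) = 0" "x v* (\<chi> i j. complex_of_real (A $ i $ j)) = c *s x"
    and c: "1 \<le> cmod c"
  shows "x = 0"
proof (rule ccontr)
  assume "x \<noteq> 0"
  define C :: "complex ^ 'n ^ 'n" where "C = (\<chi> i j. complex_of_real (A $ i $ j))"
  define M :: "complex poly ^ 'n ^ 'n"
    where "M = (\<chi> i j. (if i = j then [:0, 1:] else 0) - [:C $ i $ j:])"
  \<comment> \<open>Here \<open>undefined\<close> stands for an arbitrary column index.\<close>
  define k :: 'n where "k = undefined"
  define D where "D = det (\<chi> i j. if j = k then 1 else M $ i $ j)"
  have rowsC: "(\<Sum>b\<in>UNIV. C $ a $ b) = 1" for a
    by (simp add: C_def rows flip: of_real_sum)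
  have "(\<Sum>j\<in>UNIV. [:C $ i $ j:]) = [:1:]" for i
  proof -
    have "(\<Sum>j\<in>J. [:C $ i $ j:]) = [:\<Sum>j\<in>J. C $ i $ j:]" for J :: "'n set"
      by (induction J rule: infinite_finite_induct) simp_all
    then show ?thesis by (simp add: rowsC)
  qed
  then have "(\<Sum>j\<in>UNIV. M $ i $ j) = [:- 1, 1:]" for i
    by (simp add: M_def sum_subtractf)
  then have factor: "characteristic_poly C = [:- 1, 1:] * D"
    unfolding characteristic_poly_def M_def[symmetric] D_def by (rule det_equal_row_sums)
  \<comment> \<open>Column \<open>k\<close> of the matrix below is constant, so it is killed by \<open>x\<close> because \<open>x\<close> sums to zero.\<close>
  have "x v* (\<chi> i j. if j = k then 1 else (if i = j then c else 0) - C $ i $ j) = 0"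
  proof (subst vec_eq_iff, intro allI)
    fix j
    have "(x v* (\<chi> i j. (if i = j then c else 0) - C $ i $ j)) $ j = 0"
      using x(2) unfolding vector_mult_characteristic_matrix C_def by simp
    then show "(x v* (\<chi> i j. if j = k then 1 else (if i = j then c else 0) - C $ i $ j)) $ j = 0 $ j"
      using x(1) by (cases "j = k") (simp_all add: vector_matrix_mult_def)
  qed
  moreover have "poly D c = det (\<chi> i j. if j = k then 1 else (if i = j then c else 0) - C $ i $ j)"
    unfolding D_def poly_det by (intro arg_cong[of _ _ det]) (simp add: vec_eq_iff M_def)
  ultimately have Dc: "poly D c = 0"
    using \<open>x \<noteq> 0\<close> by (auto simp: det_eq_0_iff_left_kernel)
  \<comment> \<open>\<open>proots 0\<close> is empty, so it matters that the characteristic polynomial is not zero;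
    indeed \<open>2\<close> is not an eigenvalue.\<close>
  have "poly (characteristic_poly C) 2 \<noteq> 0"
  proof
    assume "poly (characteristic_poly C) 2 = 0"
    then obtain y where y: "y \<noteq> 0" "y v* C = 2 *s y"
      by (auto simp: poly_characteristic_poly det_eq_0_iff_left_kernel
          vector_mult_characteristic_matrix)
    have "(\<Sum>b\<in>UNIV. norm ((2 *s y) $ b)) \<le> (\<Sum>b\<in>UNIV. norm (y $ b))"
      using l1_vector_stochastic_le[of A y] nonneg rows y(2) by (simp add: C_def)
    then have "(\<Sum>b\<in>UNIV. norm (y $ b)) \<le> 0"
      by (simp add: norm_mult flip: sum_distrib_left)
    then have "(\<Sum>b\<in>UNIV. norm (y $ b)) = 0"
      by (simp add: order.antisym sum_nonneg)
    then have "y = 0"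
      by (simp add: vec_eq_iff sum_nonneg_eq_0_iff)
    then show False using y(1) by simp
  qed
  then have "D \<noteq> 0" by (auto simp: factor)
  then have "eigenvalues A = {#1#} + proots D"
    using proots_mult[of "[:- 1, 1:]" D] by (simp add: eigenvalues_def factor flip: C_def del: mult_pCons_left)
  then have "c \<in># eigenvalues A - {#1#}"
    using Dc \<open>D \<noteq> 0\<close> by simp
  then show False using erg c by (auto simp: ergodic_def)
qed

text \<open>The limit is taken for the complexified vector, where polynomials have roots, and real
  parts are read off at the end.\<close>

lemma ergodic_powers_tendsto_zero:
  fixes A :: "real ^ 'n ^ 'n"
  assumes nonneg: "\<And>a b. 0 \<le> A $ a $ b" and rows: "\<And>a. (\<Sum>b\<in>UNIV. A $ a $ b) = 1"
    and erg: "ergodic A" and x: "(\<Sum>a\<in>UNIV. x $ a) = 0"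
  shows "(\<lambda>k. x v* matrix_pow A k) \<longlonglongrightarrow> 0"
proof -
  define C :: "complex ^ 'n ^ 'n" where "C = (\<chi> i j. complex_of_real (A $ i $ j))"
  define V :: "(complex ^ 'n) set" where "V = {y. (\<Sum>a\<in>UNIV. y $ a) = 0}"
  define z :: "complex ^ 'n" where "z = (\<chi> a. complex_of_real (x $ a))"
  have rowsC: "(\<Sum>b\<in>UNIV. C $ a $ b) = 1" for a
    by (simp add: C_def rows flip: of_real_sum)
  have V: "vec.subspace V"
    by (rule vec.subspaceI) (simp_all add: V_def sum.distrib flip: sum_distrib_left)
  have inv: "y v* C \<in> V" if "y \<in> V" for y
    using that sum_vector_matrix_mult[OF rowsC] by (simp add: V_def)
  have no_eig: "y = 0" if "y \<in> V" "y v* C = c *s y" "1 \<le> cmod c" for y c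
    using ergodic_no_eigenvector[OF nonneg rows erg, of y c] that by (simp add: V_def C_def)
  have "z \<in> V" using x by (simp add: V_def z_def flip: of_real_sum)
  have lim: "(\<lambda>k. ((\<lambda>y. y v* C) ^^ k) z) \<longlonglongrightarrow> 0"
    by (rule powers_tendsto_zero_on_subspace[OF V inv no_eig \<open>z \<in> V\<close>])
  have eq: "((\<lambda>y. y v* C) ^^ k) z = (\<chi> a. complex_of_real ((x v* matrix_pow A k) $ a))" for k
  proof (induction k)
    case 0
    show ?case by (simp add: z_def)
  next
    case (Suc k)
    have "x v* matrix_pow A (Suc k) = (x v* matrix_pow A k) v* A"
      by (simp add: vector_matrix_mul_assoc)
    then show ?case using Suc.IH by (simp add: C_def vector_matrix_mult_def vec_eq_iff)
  qed
  show ?thesis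
  proof (rule vec_tendstoI)
    fix a
    have "(\<lambda>k. Re (((\<lambda>y. y v* C) ^^ k) z $ a)) \<longlonglongrightarrow> Re (0 $ a)"
      by (intro tendsto_Re tendsto_vec_nth lim)
    then show "(\<lambda>k. (x v* matrix_pow A k) $ a) \<longlonglongrightarrow> 0 $ a" by (simp add: eq)
  qed
qed

section \<open>The uniform vector: continuity and polytopes\<close>

lemma sum_uniform_vector: "(\<Sum>a\<in>UNIV. (uniform_vector :: real ^ 'n::finite) $ a) = 1"
  by (simp add: uniform_vector_def)

lemma uniform_vector_doubly_stochastic:
  "doubly_stochastic Q \<Longrightarrow> uniform_vector v* Q = uniform_vector"
  by (simp add: doubly_stochastic_def uniform_vector_def vector_matrix_mult_def vec_eq_iff
      flip: sum_divide_distrib)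

text \<open>The constant doubly stochastic matrix averages the components. Membership makes the
  polytope nonempty and one half of the Hausdorff distance vanish.\<close>

lemma uniform_vector_in_polytope:
  fixes x :: "real ^ 'n"
  assumes "(\<Sum>a\<in>UNIV. x $ a) = 1"
  shows "uniform_vector \<in> polytope_of x"
proof -
  define J :: "real ^ 'n ^ 'n" where "J = (\<chi> i j. 1 / real CARD('n))"
  have "x v* J = uniform_vector"
    using assms by (simp add: J_def vector_matrix_mult_def uniform_vector_def vec_eq_iff
        flip: sum_divide_distrib)
  moreover have "doubly_stochastic J" by (simp add: J_def doubly_stochastic_def)
  ultimately show ?thesis unfolding polytope_of_def by (intro CollectI exI[of _ J]) simp
qed

text \<open>Components of \<open>q k\<close> may vanish, but those of the limit are positive, and
  the logarithm is continuous there.\<close>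

lemma tendsto_entropy_uniform:
  fixes q :: "nat \<Rightarrow> real ^ 'n"
  assumes "q \<longlonglongrightarrow> uniform_vector"
  shows "(\<lambda>k. entropy (q k)) \<longlonglongrightarrow> ln (real CARD('n))"
proof -
  have "(\<lambda>k. entropy (q k)) \<longlonglongrightarrow> entropy (uniform_vector :: real ^ 'n)"
    unfolding entropy_def
    by (intro tendsto_minus tendsto_sum tendsto_mult tendsto_ln tendsto_vec_nth assms)
      (simp add: uniform_vector_def)
  also have "entropy (uniform_vector :: real ^ 'n) = ln (real CARD('n))"
    by (simp add: entropy_def uniform_vector_def ln_div)
  finally show ?thesis .
qed

lemma tendsto_gini_uniform:
  fixes q :: "nat \<Rightarrow> real ^ 'n"
  assumes "q \<longlonglongrightarrow> uniform_vector"
  shows "(\<lambda>k. gini (q k)) \<longlonglongrightarrow> 0"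
proof -
  have "(\<lambda>k. gini (q k)) \<longlonglongrightarrow> gini (uniform_vector :: real ^ 'n)"
    unfolding gini_def by (intro tendsto_intros assms)
  then show ?thesis by (simp add: gini_def uniform_vector_def)
qed

text \<open>For u the uniform vector, x Q - u = (x - u) Q, so the Euclidean distance of x Q from u
  is at most the L1 norm of x - u, which is twice the total variation distance.\<close>

lemma hausdorff_distance_polytope_uniform:
  fixes x :: "real ^ 'n"
  assumes "(\<Sum>a\<in>UNIV. x $ a) = 1"
  shows "0 \<le> hausdorff_distance (polytope_of x) {uniform_vector}"
    and "hausdorff_distance (polytope_of x) {uniform_vector} \<le> 2 * tv_dist x uniform_vector"
proof -
  have u: "uniform_vector \<in> polytope_of x" by (rule uniform_vector_in_polytope[OF assms])
  have eq: "hausdorff_distance (polytope_of x) {uniform_vector}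
      = max (SUP y\<in>polytope_of x. dist y uniform_vector) 0"
    using u by (simp add: hausdorff_distance_def)
  have "dist y uniform_vector \<le> 2 * tv_dist x uniform_vector" if y: "y \<in> polytope_of x" for y
  proof -
    obtain Q where Q: "y = x v* Q" "doubly_stochastic Q"
      using y by (auto simp: polytope_of_def)
    have "y - uniform_vector = (x - uniform_vector) v* Q"
      by (simp add: Q uniform_vector_doubly_stochastic vector_matrix_mult_diff_distrib)
    then have "dist y uniform_vector \<le> (\<Sum>b\<in>UNIV. \<bar>((x - uniform_vector) v* Q) $ b\<bar>)"
      by (metis dist_norm norm_le_l1_cart)
    also have "\<dots> \<le> 2 * tv_dist x uniform_vector"
      using l1_vector_doubly_stochastic_le[OF Q(2), of "x - uniform_vector"]
      by (simp add: tv_dist_def)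
    finally show ?thesis .
  qed
  then have "(SUP y\<in>polytope_of x. dist y uniform_vector) \<le> 2 * tv_dist x uniform_vector"
    using u by (intro cSUP_least) auto
  moreover have "0 \<le> tv_dist x uniform_vector" by (simp add: tv_dist_def sum_nonneg)
  ultimately show "hausdorff_distance (polytope_of x) {uniform_vector} \<le> 2 * tv_dist x uniform_vector"
    by (simp add: eq)
  show "0 \<le> hausdorff_distance (polytope_of x) {uniform_vector}" by (simp add: eq)
qed

lemma tv_dist_doubly_stochastic_le:
  assumes "doubly_stochastic Q"
  shows "tv_dist (x v* Q) uniform_vector \<le> tv_dist x uniform_vector"
  using l1_vector_doubly_stochastic_le[OF assms, of "x - uniform_vector"]
  by (simp add: tv_dist_def vector_matrix_mult_diff_distrib uniform_vector_doubly_stochastic[OF assms])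

section \<open>The group matrix and the limit theorem\<close>

text \<open>Left translation permutes the group, and so does inversion followed by right
  translation; hence each row and each column of \<open>P\<close> lists every value of
  \<open>p\<close> once per group element.\<close>

lemma (in group) doubly_stochastic_group_matrix:
  fixes P :: "real ^ 'n::finite ^ 'n"
  assumes g: "bij_betw g UNIV (carrier G)"
    and p: "\<And>x. x \<in> carrier G \<Longrightarrow> p x \<ge> 0" "(\<Sum>x\<in>carrier G. p x) = 1"
    and P: "\<And>a b. P $ a $ b = p (inv (g a) \<otimes> g b)"
  shows "doubly_stochastic P"
proof -
  have gc: "g a \<in> carrier G" for a using g by (auto simp: bij_betw_def)
  have "(\<Sum>b\<in>UNIV. P $ a $ b) = 1" for a
  proof -
    have "(\<Sum>b\<in>UNIV. P $ a $ b) = (\<Sum>y\<in>carrier G. p (inv (g a) \<otimes> y))"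
      unfolding P by (rule sum.reindex_bij_betw[OF g])
    also have "\<dots> = (\<Sum>x\<in>carrier G. p x)"
      by (rule sum.reindex_bij_witness[of _ "\<lambda>x. g a \<otimes> x" "\<lambda>y. inv (g a) \<otimes> y"])
        (simp_all add: gc flip: m_assoc)
    finally show ?thesis using p(2) by simp
  qed
  moreover have "(\<Sum>a\<in>UNIV. P $ a $ b) = 1" for b
  proof -
    have "(\<Sum>a\<in>UNIV. P $ a $ b) = (\<Sum>y\<in>carrier G. p (inv y \<otimes> g b))"
      unfolding P by (rule sum.reindex_bij_betw[OF g])
    also have "\<dots> = (\<Sum>x\<in>carrier G. p x)"
      by (rule sum.reindex_bij_witness[of _ "\<lambda>x. g b \<otimes> inv x" "\<lambda>y. inv y \<otimes> g b"])
        (simp_all add: gc inv_mult_group m_assoc, simp_all add: gc flip: m_assoc)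
    finally show ?thesis using p(2) by simp
  qed
  ultimately show ?thesis by (simp add: doubly_stochastic_def P p(1) gc)
qed

theorem propositionV3:
  fixes G :: "('g, 'm) monoid_scheme"
    and g :: "'n::finite \<Rightarrow> 'g"
    and p :: "'g \<Rightarrow> real"
    and P :: "real ^ 'n ^ 'n"
    and q :: "nat \<Rightarrow> real ^ 'n"
    and q0 :: "real ^ 'n"
  assumes "comm_group G"
    and "finite (carrier G)"
    and "bij_betw g UNIV (carrier G)"
    and "\<And>x. x \<in> carrier G \<Longrightarrow> p x \<ge> 0"
    and "(\<Sum>x\<in>carrier G. p x) = 1"
    and "\<And>a b. P $ a $ b = p (inv\<^bsub>G\<^esub> (g a) \<otimes>\<^bsub>G\<^esub> g b)"
    and "ergodic P"
    and "prob_vector q0"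
    and "\<And>k. q k = q0 v* matrix_pow P k"
  shows "q \<longlonglongrightarrow> uniform_vector
    \<and> (\<lambda>k. entropy (q k)) \<longlonglongrightarrow> ln (real CARD('n))
    \<and> (\<lambda>k. gini (q k)) \<longlonglongrightarrow> 0
    \<and> (\<lambda>k. hausdorff_distance (polytope_of (q k)) {uniform_vector}) \<longlonglongrightarrow> 0
    \<and> (\<forall>k. tv_dist (q k) uniform_vector \<ge> tv_dist (q (Suc k)) uniform_vector)"
proof -
  interpret comm_group G by fact
  have ds: "doubly_stochastic P"
    by (rule doubly_stochastic_group_matrix[OF assms(3-6)])
  have nonneg: "0 \<le> P $ a $ b" and rows: "(\<Sum>b\<in>UNIV. P $ a $ b) = 1" for a b
    using ds by (auto simp: doubly_stochastic_def)
  have step: "q (Suc k) = q k v* P" for k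
    by (simp add: assms(9) vector_matrix_mul_assoc)
  \<comment> \<open>The Hausdorff bounds assume unit sum of each \<open>q k\<close>.\<close>
  have sum_q: "(\<Sum>a\<in>UNIV. q k $ a) = 1" for k
  proof (induction k)
    case 0
    show ?case using assms(8) by (simp add: assms(9) prob_vector_def)
  next
    case (Suc k)
    then show ?case using sum_vector_matrix_mult[of P "q k"] rows by (simp add: step)
  qed
  \<comment> \<open>Since the powers of \<open>P\<close> fix the uniform vector, the deviation from
    it evolves linearly, starting from component sum zero.\<close>
  have "uniform_vector v* matrix_pow P k = uniform_vector" for k
    by (induction k) (simp_all add: uniform_vector_doubly_stochastic[OF ds] flip: vector_matrix_mul_assoc)
  then have "q k - uniform_vector = (q0 - uniform_vector) v* matrix_pow P k" for k
    by (simp add: assms(9) vector_matrix_mult_diff_distrib)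
  moreover have "(\<lambda>k. (q0 - uniform_vector) v* matrix_pow P k) \<longlonglongrightarrow> 0"
    using assms(8)
    by (intro ergodic_powers_tendsto_zero nonneg rows assms(7))
      (simp add: prob_vector_def sum_subtractf sum_uniform_vector)
  ultimately have lim: "q \<longlonglongrightarrow> uniform_vector"
    by (simp add: LIM_zero_iff[of q, symmetric])
  have "(\<lambda>k. 2 * tv_dist (q k) uniform_vector) \<longlonglongrightarrow> 2 * tv_dist uniform_vector (uniform_vector :: real ^ 'n)"
    unfolding tv_dist_def by (intro tendsto_intros lim)
  then have tv: "(\<lambda>k. 2 * tv_dist (q k) uniform_vector) \<longlonglongrightarrow> 0"
    by (simp add: tv_dist_def)
  have "(\<lambda>k. hausdorff_distance (polytope_of (q k)) {uniform_vector}) \<longlonglongrightarrow> 0"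
    by (rule tendsto_sandwich[OF _ _ tendsto_const tv])
      (simp_all add: hausdorff_distance_polytope_uniform sum_q)
  then show ?thesis
    using lim tendsto_entropy_uniform[OF lim] tendsto_gini_uniform[OF lim]
      tv_dist_doubly_stochastic_le[OF ds] by (simp add: step)
qed

end
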